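(* Let $\phi_1=\inf_{y\in E}\gamma(y)$ and $\phi_2=\sup_{y\in E}\gamma(y)$. Assume that the integrals $$\int_E\gamma(y)\left(1-\frac{\gamma(y)}{\phi_1}\right)^{-\delta_1}\nu(dy)\quad\text{and}\quad\int_E\gamma(y)\left(1-\frac{\gamma(y)}{\phi_2}\right)^{-\delta_1}\nu(dy)$$ are well-defined or, at most, are $\pm\infty$. If the model parameters are such that $$\mu-r+\frac{\delta_1\sigma^2}{\phi_2}+\int_E\gamma(y)\left(1-\frac{\gamma(y)}{\phi_2}\right)^{-\delta_1}\nu(dy)\ge0,$$ $$\mu-r+\frac{\delta_1\sigma^2}{\phi_1}+\int_E\gamma(y)\left(1-\frac{\gamma(y)}{\phi_1}\right)^{-\delta_1}\nu(dy)\le0,$$ then there exists a unique $\hat m$ that solves the equation $$\mu-r-\delta_1\sigma^2m+\int_E\frac{\gamma(y)}{(1+\gamma(y)m)^{\delta_1}}\nu(dy)=0 .$$ Moreover: (i) if $-1\le\phi_1$ and $\phi_2<0$, then $\hat m\in(-\infty,-1/\phi_1)$; (ii) if $0<\phi_1$ and $\phi_2<+\infty$, then $\hat m\in(-1/\phi_2,+\infty)$; (iii) if $-1\le\phi_1<0<\phi_2<+\infty$, then $\hat m\in(-1/\phi_2,-1/\phi_1)$.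
   Context: $\mu\in\mathbb R$, $r>0$, $\sigma>0$, $\delta_1\in(0,1)$ are constants. $\nu$ is a $\sigma$-finite measure with support in a measurable set $E\subseteq\mathbb R$ (the compensator of a homogeneous Poisson random measure is $\nu(dy)\,dt$), and $\gamma$ is a continuous (time-independent) jump-size function whose set of values satisfies $\gamma(E)\subseteq[-1,+\infty)$. These are the parameters of a stock with dynamics $dS_t/S_{t-}=\mu\,dt+\sigma\,dW_t+\int_E\gamma(y)N(dt,dy)$. The equation for $m$ is regarded as well defined only where $1+\gamma(y)m>0$.
   Formalization: φ1, φ2 are nonzero; the φ2-condition is imposed only if φ2>0, the φ1-condition only if φ1<0; if φ2<0 or φ1>0, γ is assumed ν-integrable; 1+γm>0 is required ν-a.e.; the open intervals hold when the relevant inequalities are strict, and under equality m̂ is the endpoint. *)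

theory Defs
  imports "HOL-Analysis.Analysis"
begin

text \<open>
  \<open>neg_power x \<delta>\<close> is \<open>x\<close> to the power \<open>-\<delta>\<close> for \<open>0 \<le> x < \<infinity>\<close> and \<open>\<delta> > 0\<close>. The base 0, which occurs
  where the jump size attains its infimum or supremum, gives \<open>\<infinity>\<close>, whereas \<open>powr\<close> would give 0.
\<close>
definition neg_power :: "ereal \<Rightarrow> real \<Rightarrow> ereal" where
  "neg_power x \<delta> = (if x = 0 then \<infinity> else ereal (real_of_ereal x powr (- \<delta>)))"

text \<open>
  The integrand of the boundary integrals. For \<open>\<phi> = \<infinity>\<close> the quotient is 0. The base is nonnegative
  for every \<open>y \<in> E\<close> if \<open>\<phi>\<close> is the supremum of \<open>\<gamma>\<close> on \<open>E\<close> and positive, or the infimum and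
  negative; these are the only cases in which the integrand is used.
\<close>
definition boundary_integrand :: "real \<Rightarrow> (real \<Rightarrow> real) \<Rightarrow> ereal \<Rightarrow> real \<Rightarrow> ereal" where
  "boundary_integrand \<delta> \<gamma> \<phi> y = ereal (\<gamma> y) * neg_power (1 - ereal (\<gamma> y) / \<phi>) \<delta>"

text \<open>
  Lebesgue integral with values in the extended reals. \<open>e2ennreal\<close> sends negative numbers to 0, so
  the two terms are the integrals of the positive and of the negative part.
\<close>
definition ext_integral :: "real measure \<Rightarrow> real set \<Rightarrow> (real \<Rightarrow> ereal) \<Rightarrow> ereal" where
  "ext_integral \<nu> E h =
     enn2ereal (\<integral>\<^sup>+y\<in>E. e2ennreal (h y) \<partial>\<nu>) - enn2ereal (\<integral>\<^sup>+y\<in>E. e2ennreal (- h y) \<partial>\<nu>)"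

text \<open>The integral exists as a real number or as \<open>\<infinity>\<close> or \<open>-\<infinity>\<close>, i.e. is not of the form \<open>\<infinity> - \<infinity>\<close>.\<close>
definition ext_integral_exists :: "real measure \<Rightarrow> real set \<Rightarrow> (real \<Rightarrow> ereal) \<Rightarrow> bool" where
  "ext_integral_exists \<nu> E h \<longleftrightarrow>
     (\<integral>\<^sup>+y\<in>E. e2ennreal (h y) \<partial>\<nu>) < \<infinity> \<or> (\<integral>\<^sup>+y\<in>E. e2ennreal (- h y) \<partial>\<nu>) < \<infinity>"

text \<open>
  The equation for \<open>m\<close>, including that it is well defined: \<open>1 + \<gamma>(y) m > 0\<close> for almost every jump
  mark \<open>y\<close>, and a finite integral (the Bochner integral of a non-integrable function is 0).
\<close>
definition solves_equation ::
  "real \<Rightarrow> real \<Rightarrow> real \<Rightarrow> real \<Rightarrow> real measure \<Rightarrow> real set \<Rightarrow> (real \<Rightarrow> real) \<Rightarrow> real \<Rightarrow> bool" where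
  "solves_equation \<mu> r \<sigma> \<delta> \<nu> E \<gamma> m \<longleftrightarrow>
     (AE y in \<nu>. y \<in> E \<longrightarrow> 1 + \<gamma> y * m > 0) \<and>
     set_integrable \<nu> E (\<lambda>y. \<gamma> y / (1 + \<gamma> y * m) powr \<delta>) \<and>
     \<mu> - r - \<delta> * \<sigma>\<^sup>2 * m + (LINT y:E|\<nu>. \<gamma> y / (1 + \<gamma> y * m) powr \<delta>) = 0"

end

theory Submission
  imports Defs
begin

text \<open>
  For every mark the jump term is decreasing in \<open>m\<close>, so the left-hand side \<open>F\<close> of the equation is
  strictly decreasing, which gives uniqueness; by monotonicity the integrands at two points dominate
  those in between, so \<open>F\<close> is continuous and the intermediate value theorem applies. At the
  endpoints \<open>-1/\<phi>\<^sub>2\<close> and \<open>-1/\<phi>\<^sub>1\<close> the boundary values are the values of \<open>F\<close> whenever they are finite,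
  and otherwise Fatou's lemma shows that \<open>F\<close> takes the required sign near the endpoint. In the
  two-sided case integrability inside the interval comes from the endpoints, because \<open>1 + \<gamma> m\<close> is
  a convex combination of its nonnegative endpoint values.
\<close>

section \<open>The jump term as a function of \<open>m\<close>\<close>

definition jump :: "real \<Rightarrow> real \<Rightarrow> real \<Rightarrow> real" where
  "jump \<delta> m x = x / (1 + x * m) powr \<delta>"

text \<open>With \<open>m\<close> equal to -1/\<phi> the base 1 - x/\<phi> becomes
  \<open>1 + x * m\<close>, so this is the boundary integrand in terms of \<open>m\<close>. It
  differs from \<open>jump\<close> where the base is 0: there it is infinite with the sign of
  \<open>x\<close>, whereas division by zero makes \<open>jump\<close> equal to 0.\<close>

definition boundary_jump :: "real \<Rightarrow> real \<Rightarrow> real \<Rightarrow> ereal" where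
  "boundary_jump \<delta> m x = ereal x * neg_power (ereal (1 + x * m)) \<delta>"

lemma jump_measurable [measurable]: "jump \<delta> m \<in> borel_measurable borel"
  unfolding jump_def by measurable

lemma boundary_jump_eq:
  "boundary_jump \<delta> m x =
    (if 1 + x * m = 0 then ereal x * \<infinity> else ereal (jump \<delta> m x))"
  unfolding boundary_jump_def jump_def neg_power_def
  by (auto simp: powr_minus_divide simp flip: zero_ereal_def)

lemma boundary_jump_measurable [measurable]: "boundary_jump \<delta> m \<in> borel_measurable borel"
  unfolding boundary_jump_eq by measurable

lemma jump_uminus: "jump \<delta> (-m) (-x) = - jump \<delta> m x"
  by (simp add: jump_def)

lemma boundary_jump_uminus: "boundary_jump \<delta> (-m) (-x) = - boundary_jump \<delta> m x"
  by (simp add: boundary_jump_def flip: uminus_ereal.simps)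

text \<open>For nonnegative \<open>x\<close> the denominator grows with \<open>m\<close>; for
  negative \<open>x\<close> it shrinks, but the numerator is negative, so the quotient decreases
  again.\<close>

lemma jump_antimono:
  assumes "0 < \<delta>" "m \<le> m'" "0 < 1 + x * m" "0 < 1 + x * m'"
  shows "jump \<delta> m' x \<le> jump \<delta> m x"
proof (cases "0 \<le> x")
  case True
  then have "(1 + x * m) powr \<delta> \<le> (1 + x * m') powr \<delta>"
    using assms by (intro powr_mono2) (auto intro: mult_left_mono)
  then show ?thesis
    using assms True unfolding jump_def by (intro divide_left_mono) auto
next
  case False
  then have "(1 + x * m') powr \<delta> \<le> (1 + x * m) powr \<delta>"
    using assms by (intro powr_mono2) (auto intro: mult_left_mono_neg)
  then show ?thesis
    using assms False unfolding jump_def by (intro divide_left_mono_neg) auto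
qed

lemma positive_between:
  fixes x :: real
  assumes "0 < 1 + x * a" "0 < 1 + x * b" "a \<le> m" "m \<le> b"
  shows "0 < 1 + x * m"
proof (cases "0 \<le> x")
  case True
  then show ?thesis using mult_left_mono[OF assms(3) True] assms by linarith
next
  case False
  then show ?thesis using mult_left_mono_neg[OF assms(4), of x] assms by linarith
qed

lemma abs_jump_le:
  assumes "0 < \<delta>" "0 < e" "e \<le> 1 + x * m"
  shows "\<bar>jump \<delta> m x\<bar> \<le> \<bar>x\<bar> / e powr \<delta>"
proof -
  have "e powr \<delta> \<le> (1 + x * m) powr \<delta>"
    using assms by (intro powr_mono2) auto
  then show ?thesis
    using assms unfolding jump_def abs_divide by (auto intro!: divide_left_mono)
qed

text \<open>The integrand function \<open>f\<close> and the constant \<open>c\<close> are kept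
  general so that the theory can be applied to \<open>- f\<close> and \<open>- c\<close> as well,
  which turns results about left endpoints into results about right endpoints.\<close>

locale jump_equation =
  fixes M :: "'a measure" and f :: "'a \<Rightarrow> real" and c k \<delta> :: real
  assumes f_measurable [measurable]: "f \<in> borel_measurable M"
    and k_pos: "0 < k" and \<delta>_pos: "0 < \<delta>"
begin

text \<open>These are the points where the equation is well defined. The value \<open>F m\<close> is
  meaningful only there, since a non-integrable jump term would contribute the default integral
  0.\<close>

definition admissible :: "real \<Rightarrow> bool" where
  "admissible m \<longleftrightarrow> (AE y in M. 0 < 1 + f y * m) \<and> integrable M (\<lambda>y. jump \<delta> m (f y))"

definition F :: "real \<Rightarrow> real" where
  "F m = c - k * m + (LINT y|M. jump \<delta> m (f y))"

section \<open>Monotonicity, uniqueness, continuity and intermediate values\<close>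

lemma F_strict_decreasing:
  assumes "admissible m" "admissible m'" "m < m'"
  shows "F m' < F m"
proof -
  have "(LINT y|M. jump \<delta> m' (f y)) \<le> (LINT y|M. jump \<delta> m (f y))"
  proof (rule integral_mono_AE)
    show "AE y in M. jump \<delta> m' (f y) \<le> jump \<delta> m (f y)"
      using assms(1)[unfolded admissible_def, THEN conjunct1]
        assms(2)[unfolded admissible_def, THEN conjunct1]
      by eventually_elim (use assms(3) in \<open>auto intro: jump_antimono \<delta>_pos\<close>)
  qed (use assms in \<open>auto simp: admissible_def\<close>)
  \<comment> \<open>The strictness comes from the linear term; the integrals are only weakly
    ordered.\<close>
  moreover have "k * m < k * m'" using assms k_pos by simp
  ultimately show ?thesis unfolding F_def by linarith
qed

lemma zero_unique:
  assumes "admissible m" "admissible m'" "F m = 0" "F m' = 0"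
  shows "m = m'"
  using F_strict_decreasing[of m m'] F_strict_decreasing[of m' m] assms by linarith

text \<open>A decreasing function lies between its endpoint values. The quantifier over
  \<open>m\<close> stands inside the AE, so that one null set serves the whole interval and every
  sequence in it.\<close>

lemma jump_between:
  assumes "admissible a" "admissible b"
  shows "AE y in M. \<forall>m\<in>{a..b}. 0 < 1 + f y * m \<and>
           \<bar>jump \<delta> m (f y)\<bar> \<le> \<bar>jump \<delta> a (f y)\<bar> + \<bar>jump \<delta> b (f y)\<bar>"
proof -
  have "AE y in M. 0 < 1 + f y * a" "AE y in M. 0 < 1 + f y * b"
    using assms by (auto simp: admissible_def)
  then show ?thesis
  proof eventually_elim
    case (elim y)
    show ?case
    proof (intro ballI conjI)
      fix m assume m: "m \<in> {a..b}"
      then show pos: "0 < 1 + f y * m"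
        using positive_between[OF elim] by auto
      have "jump \<delta> b (f y) \<le> jump \<delta> m (f y)" "jump \<delta> m (f y) \<le> jump \<delta> a (f y)"
        using m pos elim \<delta>_pos by (auto intro: jump_antimono)
      then show "\<bar>jump \<delta> m (f y)\<bar> \<le> \<bar>jump \<delta> a (f y)\<bar> + \<bar>jump \<delta> b (f y)\<bar>"
        by linarith
    qed
  qed
qed

lemma admissible_between:
  assumes "admissible a" "admissible b" "a \<le> m" "m \<le> b"
  shows "admissible m"
  unfolding admissible_def
proof
  note between = jump_between[OF assms(1,2)]
  show "AE y in M. 0 < 1 + f y * m"
    using between by eventually_elim (use assms in auto)
  show "integrable M (\<lambda>y. jump \<delta> m (f y))"
  proof (rule Bochner_Integration.integrable_bound)
    show "integrable M (\<lambda>y. \<bar>jump \<delta> a (f y)\<bar> + \<bar>jump \<delta> b (f y)\<bar>)"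
      using assms by (auto simp: admissible_def)
    show "AE y in M. norm (jump \<delta> m (f y)) \<le> norm (\<bar>jump \<delta> a (f y)\<bar> + \<bar>jump \<delta> b (f y)\<bar>)"
      using between by eventually_elim (use assms in force)
  qed measurable
qed

lemma continuous_on_F:
  assumes "admissible a" "admissible b"
  shows "continuous_on {a..b} F"
proof (subst continuous_on_sequentially, intro allI ballI impI)
  fix u :: "nat \<Rightarrow> real" and m
  assume "m \<in> {a..b}" and u: "(\<forall>n. u n \<in> {a..b}) \<and> u \<longlonglongrightarrow> m"
  note between = jump_between[OF assms]
  have "(\<lambda>n. LINT y|M. jump \<delta> (u n) (f y)) \<longlonglongrightarrow> (LINT y|M. jump \<delta> m (f y))"
  proof (rule integral_dominated_convergence)
    show "integrable M (\<lambda>y. \<bar>jump \<delta> a (f y)\<bar> + \<bar>jump \<delta> b (f y)\<bar>)"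
      using assms by (auto simp: admissible_def)
    show "AE y in M. norm (jump \<delta> (u n) (f y)) \<le> \<bar>jump \<delta> a (f y)\<bar> + \<bar>jump \<delta> b (f y)\<bar>" for n
      using between by eventually_elim (use u in auto)
    show "AE y in M. (\<lambda>n. jump \<delta> (u n) (f y)) \<longlonglongrightarrow> jump \<delta> m (f y)"
      using between
    proof eventually_elim
      case (elim y)
      then have "0 < 1 + f y * m" using \<open>m \<in> {a..b}\<close> by auto
      then show ?case
        unfolding jump_def using u by (intro tendsto_intros) auto
    qed
  qed measurable
  then show "(F \<circ> u) \<longlonglongrightarrow> F m"
    unfolding F_def comp_def using u by (intro tendsto_intros) auto
qed

lemma zero_between:
  assumes "admissible a" "admissible b" "0 \<le> F a" "F b \<le> 0"
  obtains m where "a \<le> m" "m \<le> b" "admissible m" "F m = 0"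
proof -
  \<comment> \<open>The order of the two points is forced by the signs, as \<open>F\<close> is
    decreasing.\<close>
  have "a \<le> b"
    using F_strict_decreasing[of b a] assms by linarith
  then obtain m where "a \<le> m" "m \<le> b" "F m = 0"
    using IVT2'[of F b 0 a] continuous_on_F assms by blast
  then show ?thesis using that admissible_between assms by blast
qed

section \<open>Boundary values and the left endpoint\<close>

definition boundary_pos :: "real \<Rightarrow> ennreal" where
  "boundary_pos a = (\<integral>\<^sup>+y. e2ennreal (boundary_jump \<delta> a (f y)) \<partial>M)"

definition boundary_neg :: "real \<Rightarrow> ennreal" where
  "boundary_neg a = (\<integral>\<^sup>+y. e2ennreal (- boundary_jump \<delta> a (f y)) \<partial>M)"

definition boundary_value :: "real \<Rightarrow> ereal" where
  "boundary_value a = ereal (c - k * a) + (enn2ereal (boundary_pos a) - enn2ereal (boundary_neg a))"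

text \<open>A vanishing base forces a nonzero jump size and hence an infinite integrand. Finite
  integrals allow this only on a null set, and elsewhere \<open>boundary_jump\<close> and
  \<open>jump\<close> agree.\<close>

lemma boundary_value_finite:
  assumes nonneg: "AE y in M. 0 \<le> 1 + f y * a"
    and pos: "boundary_pos a < \<infinity>" and neg: "boundary_neg a < \<infinity>"
  shows "admissible a" "boundary_value a = ereal (F a)"
proof -
  have "AE y in M. e2ennreal (boundary_jump \<delta> a (f y)) \<noteq> \<infinity>"
    using pos unfolding boundary_pos_def by (intro nn_integral_PInf_AE) auto
  moreover have "AE y in M. e2ennreal (- boundary_jump \<delta> a (f y)) \<noteq> \<infinity>"
    using neg unfolding boundary_neg_def by (intro nn_integral_PInf_AE) auto
  ultimately have AE: "AE y in M. 0 < 1 + f y * a \<and> boundary_jump \<delta> a (f y) = ereal (jump \<delta> a (f y))"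
    using nonneg
  proof eventually_elim
    case (elim y)
    have "1 + f y * a \<noteq> 0"
    proof
      assume *: "1 + f y * a = 0"
      then have "f y < 0 \<or> 0 < f y" by (cases "f y = 0") auto
      with elim * show False
        by (auto simp: boundary_jump_eq)
    qed
    then show ?case using elim by (auto simp: boundary_jump_eq)
  qed
  then have P: "(\<integral>\<^sup>+y. ennreal (jump \<delta> a (f y)) \<partial>M) = boundary_pos a"
    unfolding boundary_pos_def
    by (intro nn_integral_cong_AE, eventually_elim) simp
  from AE have N: "(\<integral>\<^sup>+y. ennreal (- jump \<delta> a (f y)) \<partial>M) = boundary_neg a"
    unfolding boundary_neg_def
    by (intro nn_integral_cong_AE, eventually_elim) simp
  have int: "integrable M (\<lambda>y. jump \<delta> a (f y))"
    unfolding real_integrable_def P N using pos neg by auto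
  then show "admissible a"
    unfolding admissible_def using AE by (auto elim: eventually_mono)
  have "(LINT y|M. jump \<delta> a (f y)) = enn2real (boundary_pos a) - enn2real (boundary_neg a)"
    using real_lebesgue_integral_def[OF int] unfolding P N .
  moreover have "enn2ereal (boundary_pos a) = ereal (enn2real (boundary_pos a))"
    "enn2ereal (boundary_neg a) = ereal (enn2real (boundary_neg a))"
    using pos neg by (cases "boundary_pos a"; cases "boundary_neg a"; simp)+
  ultimately show "boundary_value a = ereal (F a)"
    unfolding boundary_value_def F_def by simp
qed

text \<open>If the negative part were infinite, existence of the integral would make the value
  \<open>-\<infinity>\<close>. The sign condition thus supplies the finiteness used for
  integrability inside the interval.\<close>

lemma boundary_neg_finite:
  assumes "boundary_pos a < \<infinity> \<or> boundary_neg a < \<infinity>" "0 \<le> boundary_value a"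
  shows "boundary_neg a < \<infinity>"
proof (rule ccontr)
  assume "\<not> boundary_neg a < \<infinity>"
  then have "boundary_neg a = \<infinity>" "boundary_pos a < \<infinity>"
    using assms by (auto simp: less_top[symmetric])
  then have "boundary_value a = -\<infinity>"
    unfolding boundary_value_def
    by (cases "boundary_pos a") auto
  with assms show False by simp
qed

text \<open>If \<open>F\<close> were nonpositive on all of (a, b], the integrals of the positive
  parts would stay bounded as \<open>m\<close> decreases to \<open>a\<close>, and Fatou's lemma
  would make \<open>boundary_pos a\<close> finite.\<close>

lemma eventually_F_pos:
  assumes "a < b" and adm: "\<And>m. a < m \<Longrightarrow> m \<le> b \<Longrightarrow> admissible m"
    and pos: "boundary_pos a = \<infinity>"
  shows "\<exists>m. a < m \<and> m \<le> b \<and> 0 < F m"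
proof (rule ccontr)
  assume *: "\<not> ?thesis"
  define u where "u n = a + (b - a) / real (Suc n)" for n
  have u: "a < u n" "u n \<le> b" for n
    using \<open>a < b\<close> unfolding u_def by (auto simp: field_simps mult_right_mono)
  have "(\<lambda>n. (b - a) / real (Suc n)) \<longlonglongrightarrow> 0"
    using LIMSEQ_Suc[OF lim_const_over_n] .
  then have u_lim: "u \<longlonglongrightarrow> a"
    unfolding u_def using tendsto_add[OF tendsto_const[of a]] by fastforce
  have adm_u: "admissible (u n)" for n using adm u by auto
  have adm_b: "admissible b" using adm \<open>a < b\<close> by auto
  \<comment> \<open>\<open>F (u n) \<le> 0\<close> bounds the positive part by
    \<open>k * u n - c\<close> plus the negative part. Both increase with \<open>m\<close>, so
    replacing \<open>u n\<close> by \<open>b\<close> gives a bound independent of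
    \<open>n\<close>.\<close>
  define K where "K = k * b - c + enn2real (\<integral>\<^sup>+y. ennreal (- jump \<delta> b (f y)) \<partial>M)"
  have bound: "(\<integral>\<^sup>+y. ennreal (jump \<delta> (u n) (f y)) \<partial>M) \<le> ennreal K" for n
  proof -
    have int: "integrable M (\<lambda>y. jump \<delta> (u n) (f y))" "integrable M (\<lambda>y. jump \<delta> b (f y))"
      using adm_u adm_b by (auto simp: admissible_def)
    let ?p = "\<integral>\<^sup>+y. ennreal (jump \<delta> (u n) (f y)) \<partial>M"
    let ?n = "\<integral>\<^sup>+y. ennreal (- jump \<delta> (u n) (f y)) \<partial>M"
    let ?nb = "\<integral>\<^sup>+y. ennreal (- jump \<delta> b (f y)) \<partial>M"
    have fin: "?p \<noteq> \<infinity>" "?nb \<noteq> \<infinity>" using int unfolding real_integrable_def by auto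
    have "?n \<le> ?nb"
    proof (rule nn_integral_mono_AE)
      have "AE y in M. 0 < 1 + f y * u n" "AE y in M. 0 < 1 + f y * b"
        using adm_u adm_b by (auto simp: admissible_def)
      then show "AE y in M. ennreal (- jump \<delta> (u n) (f y)) \<le> ennreal (- jump \<delta> b (f y))"
        by eventually_elim (use u \<delta>_pos in \<open>auto intro!: ennreal_leI jump_antimono\<close>)
    qed
    then have "enn2real ?n \<le> enn2real ?nb"
      using fin by (intro enn2real_mono) (auto simp: less_top)
    moreover have "(LINT y|M. jump \<delta> (u n) (f y)) = enn2real ?p - enn2real ?n"
      using real_lebesgue_integral_def[OF int(1)] .
    moreover have "F (u n) \<le> 0" using * u[of n] by force
    moreover have "k * u n \<le> k * b" using u k_pos by simp
    ultimately have "enn2real ?p \<le> K" unfolding F_def K_def by linarith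
    then show ?thesis using fin by (metis ennreal_enn2real ennreal_leI infinity_ennreal_def less_top)
  qed
  have lim: "AE y in M. (\<lambda>n. ennreal (jump \<delta> (u n) (f y))) \<longlonglongrightarrow> e2ennreal (boundary_jump \<delta> a (f y))"
  proof -
    have "AE y in M. \<forall>n. 0 < 1 + f y * u n"
      unfolding AE_all_countable using adm_u by (auto simp: admissible_def)
    then show ?thesis
    proof eventually_elim
      case (elim y)
      show ?case
      proof (cases "1 + f y * a = 0")
        case False
        then have "(\<lambda>n. jump \<delta> (u n) (f y)) \<longlonglongrightarrow> jump \<delta> a (f y)"
          unfolding jump_def using u_lim elim
          by (intro tendsto_intros) (auto intro: less_imp_le)
        then show ?thesis
          using False by (auto simp: boundary_jump_eq)
      next
        case True
        \<comment> \<open>The base vanishes at \<open>a\<close> but is positive to the right of it,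
          so the jump size is positive and the terms tend to \<infinity>, the value that
          \<open>boundary_jump\<close> takes here.\<close>
        then have eq: "1 + f y * u n = f y * (u n - a)" for n by (simp add: algebra_simps)
        have pos: "0 < f y" using elim[rule_format, of 0] u[of 0] unfolding eq
          by (simp add: zero_less_mult_iff)
        have "(\<lambda>n. f y * (u n - a)) \<longlonglongrightarrow> f y * (a - a)"
          by (intro tendsto_intros u_lim)
        then have "(\<lambda>n. (f y * (u n - a)) powr \<delta>) \<longlonglongrightarrow> 0 powr \<delta>"
          using pos u \<delta>_pos by (intro tendsto_powr2) (auto intro!: always_eventually less_imp_le)
        then have "filterlim (\<lambda>n. (1 + f y * u n) powr \<delta>) (at_right 0) sequentially"
          unfolding filterlim_at eq using pos u 
          by (auto simp: less_le intro!: always_eventually)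
        then have "filterlim (\<lambda>n. f y * inverse ((1 + f y * u n) powr \<delta>)) at_top sequentially"
          by (intro filterlim_tendsto_pos_mult_at_top[OF tendsto_const pos]
              filterlim_compose[OF filterlim_inverse_at_top_right])
        then have "(\<lambda>n. ennreal (jump \<delta> (u n) (f y))) \<longlonglongrightarrow> \<infinity>"
          unfolding jump_def divide_inverse infinity_ennreal_def ennreal_tendsto_top_eq_at_top .
        then show ?thesis using True pos by (simp add: boundary_jump_eq)
      qed
    qed
  qed
  have "boundary_pos a = (\<integral>\<^sup>+y. liminf (\<lambda>n. ennreal (jump \<delta> (u n) (f y))) \<partial>M)"
    unfolding boundary_pos_def using lim
    by (intro nn_integral_cong_AE) (auto elim!: eventually_mono dest!: lim_imp_Liminf[rotated])
  also have "\<dots> \<le> liminf (\<lambda>n. \<integral>\<^sup>+y. ennreal (jump \<delta> (u n) (f y)) \<partial>M)"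
    by (intro nn_integral_liminf) measurable
  also have "\<dots> \<le> liminf (\<lambda>n. ennreal K)"
    by (intro Liminf_mono always_eventually allI bound)
  also have "\<dots> = ennreal K" by (simp add: Liminf_const)
  finally show False using pos by (simp add: top_unique)
qed

text \<open>An infinite value is handled by the Fatou argument, a finite positive one by continuity
  from the right. The zero value is kept apart so that it can be decided later whether the solution
  is the endpoint or lies strictly inside.\<close>

lemma left_endpoint:
  assumes "a < b" and adm: "\<And>m. a < m \<Longrightarrow> m \<le> b \<Longrightarrow> admissible m"
    and nonneg: "AE y in M. 0 \<le> 1 + f y * a"
    and ex: "boundary_pos a < \<infinity> \<or> boundary_neg a < \<infinity>" and V: "0 \<le> boundary_value a"
  shows "\<exists>m. admissible m \<and> 0 \<le> F m \<and> (boundary_value a = 0 \<longrightarrow> m = a \<and> F m = 0) \<and>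
           (boundary_value a \<noteq> 0 \<longrightarrow> a < m)"
proof (cases "boundary_pos a = \<infinity>")
  case True
  have "boundary_value a = \<infinity>"
    using boundary_neg_finite[OF ex V] unfolding boundary_value_def True
    by (cases "boundary_neg a") auto
  then show ?thesis
    using eventually_F_pos[OF \<open>a < b\<close> adm True] adm by (auto intro: less_imp_le)
next
  case False
  then have fin: "admissible a" "boundary_value a = ereal (F a)"
    using boundary_value_finite[OF nonneg] boundary_neg_finite[OF ex V] by (auto simp: less_top)
  show ?thesis
  proof (cases "F a = 0")
    case True
    then show ?thesis using fin by auto
  next
    case False
    then have "0 < F a" using V fin by auto
    have "admissible b" using adm \<open>a < b\<close> by auto
    then have "continuous_on {a..b} F" using fin continuous_on_F by auto
    then have "(F \<longlongrightarrow> F a) (at a within {a..b})"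
      using \<open>a < b\<close> by (auto simp: continuous_on_def)
    then have "(F \<longlongrightarrow> F a) (at_right a)"
      using \<open>a < b\<close> by (simp add: at_within_Icc_at_right)
    then have "\<forall>\<^sub>F m in at_right a. 0 < F m"
      using \<open>0 < F a\<close> by (rule order_tendstoD)
    moreover have "\<forall>\<^sub>F m in at_right a. m \<in> {a<..<b}"
      using \<open>a < b\<close> by (rule eventually_at_right_real)
    ultimately have "\<forall>\<^sub>F m in at_right a. 0 < F m \<and> m \<in> {a<..<b}"
      by (rule eventually_conj)
    then obtain m where "0 < F m" "m \<in> {a<..<b}"
      using eventually_happens' trivial_limit_at_right_real by blast
    then show ?thesis using fin False adm
      by (intro exI[of _ m]) (auto simp: zero_ereal_def)
  qed
qed

section \<open>Jump sizes of one sign\<close>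

lemma admissible_if_integrable:
  assumes "integrable M f" "0 < e" "AE y in M. e \<le> 1 + f y * m"
  shows "admissible m"
  unfolding admissible_def
proof
  show "AE y in M. 0 < 1 + f y * m"
    using assms(3) by eventually_elim (use assms(2) in auto)
  show "integrable M (\<lambda>y. jump \<delta> m (f y))"
  proof (rule Bochner_Integration.integrable_bound)
    show "integrable M (\<lambda>y. \<bar>f y\<bar> / e powr \<delta>)" using assms by auto
    show "AE y in M. norm (jump \<delta> m (f y)) \<le> norm (\<bar>f y\<bar> / e powr \<delta>)"
      using assms(3) by eventually_elim (use abs_jump_le[OF \<delta>_pos assms(2)] in auto)
  qed measurable
qed

text \<open>For nonnegative jumps and nonnegative \<open>m\<close> the base is at least 1, so the
  jump term is at most \<open>f\<close> and the linear term wins for large \<open>m\<close>. The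
  \<open>max 0\<close> in the witness ensures that \<open>m\<close> is nonnegative.\<close>

lemma F_nonpos_at_top:
  assumes "integrable M f" "AE y in M. 0 \<le> f y"
  shows "\<exists>m. admissible m \<and> F m \<le> 0"
proof -
  define m where "m = max 0 ((c + (LINT y|M. f y)) / k)"
  have "AE y in M. 1 \<le> 1 + f y * m"
    using assms(2) by eventually_elim (auto simp: m_def)
  then have adm: "admissible m"
    by (intro admissible_if_integrable[OF assms(1), of 1]) auto
  have "(LINT y|M. jump \<delta> m (f y)) \<le> (LINT y|M. f y)"
  proof (rule integral_mono_AE)
    show "AE y in M. jump \<delta> m (f y) \<le> f y"
      using assms(2)
    proof eventually_elim
      case (elim y)
      have "0 \<le> f y * m" using elim by (simp add: m_def)
      then show ?case using abs_jump_le[OF \<delta>_pos zero_less_one, of "f y" m] elim by simp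
    qed
  qed (use adm assms in \<open>auto simp: admissible_def\<close>)
  moreover have "c + (LINT y|M. f y) \<le> k * m"
    using k_pos unfolding m_def by (simp add: pos_divide_le_eq[symmetric] mult.commute[of k])
  ultimately show ?thesis using adm unfolding F_def by (intro exI[of _ m]) linarith
qed

lemma zero_right_of:
  assumes int: "integrable M f" and f: "AE y in M. 0 \<le> f y" and "a \<le> 0"
    and nonneg: "AE y in M. 0 \<le> 1 + f y * a"
    and ex: "boundary_pos a < \<infinity> \<or> boundary_neg a < \<infinity>" and V: "0 \<le> boundary_value a"
  shows "\<exists>m. admissible m \<and> F m = 0 \<and> (boundary_value a = 0 \<longrightarrow> m = a) \<and>
           (boundary_value a \<noteq> 0 \<longrightarrow> a < m)"
proof -
  have adm: "admissible m" if "a < m" for m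
  proof (cases "0 \<le> m")
    case True
    show ?thesis
      using f by (intro admissible_if_integrable[OF int, of 1])
        (use True in \<open>auto elim!: eventually_mono\<close>)
  next
    case False
    show ?thesis
    proof (rule admissible_if_integrable[OF int])
      \<comment> \<open>For a < m < 0 the base at \<open>m\<close> is (1 - m/a) * 1 + (m/a) * (1 + f
        y * a), a convex combination of the bases at 0 and at \<open>a\<close>, hence at least 1 -
        m/a.\<close>
      show "0 < 1 - m / a" using False that by (simp add: field_simps)
      show "AE y in M. 1 - m / a \<le> 1 + f y * m"
        using nonneg
      proof eventually_elim
        case (elim y)
        have "0 \<le> (m / a) * (1 + f y * a)"
          using elim False that by (intro mult_nonneg_nonneg divide_nonpos_nonpos) auto
        also have "\<dots> = m / a + f y * m" using False that by (simp add: field_simps)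
        finally show ?case by simp
      qed
    qed
  qed
  obtain m1 where m1: "admissible m1" "0 \<le> F m1"
    "boundary_value a = 0 \<longrightarrow> m1 = a \<and> F m1 = 0" "boundary_value a \<noteq> 0 \<longrightarrow> a < m1"
    using left_endpoint[of a "a + 1", OF _ adm nonneg ex V] by auto
  obtain m2 where m2: "admissible m2" "F m2 \<le> 0" using F_nonpos_at_top[OF int f] by blast
  obtain m where "m1 \<le> m" "admissible m" "F m = 0"
    using zero_between[OF m1(1) m2(1) m1(2) m2(2)] by blast
  \<comment> \<open>If the boundary value is 0, then \<open>m1\<close> is \<open>a\<close> and
    already a zero, so uniqueness gives \<open>m = a\<close>; otherwise
    \<open>a < m1 \<le> m\<close>.\<close>
  then show ?thesis
    using m1 zero_unique[of m m1] by (intro exI[of _ m]) auto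
qed

text \<open>On marks with positive jump size the comparison of bases bounds the jump term at
  \<open>m\<close> by \<open>C powr \<delta>\<close> times the one at \<open>b\<close>; on the
  others the positive part is 0. The negative part is later obtained by reflection.\<close>

lemma integrable_pos_part_jump:
  assumes pos: "boundary_pos b < \<infinity>" and "0 < C"
    and AE: "AE y in M. 0 < 1 + f y * m \<and> (0 < f y \<longrightarrow> 0 \<le> 1 + f y * b \<and> 1 + f y * b \<le> C * (1 + f y * m))"
  shows "integrable M (\<lambda>y. max 0 (jump \<delta> m (f y)))"
proof (rule integrableI_bounded)
  have "(\<integral>\<^sup>+y. ennreal (norm (max 0 (jump \<delta> m (f y)))) \<partial>M)
      \<le> (\<integral>\<^sup>+y. ennreal (C powr \<delta>) * e2ennreal (boundary_jump \<delta> b (f y)) \<partial>M)"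
  proof (rule nn_integral_mono_AE)
    show "AE y in M. ennreal (norm (max 0 (jump \<delta> m (f y))))
        \<le> ennreal (C powr \<delta>) * e2ennreal (boundary_jump \<delta> b (f y))"
      using AE
    proof eventually_elim
      case (elim y)
      consider "f y \<le> 0" | "0 < f y" "1 + f y * b = 0" | "0 < f y" "0 < 1 + f y * b"
        using elim by fastforce
      then show ?case
      proof cases
        case 1
        then have "jump \<delta> m (f y) \<le> 0" by (auto simp: jump_def divide_nonpos_nonneg)
        then show ?thesis by (simp add: max_absorb1)
      next
        \<comment> \<open>The right-hand side is infinite here.\<close>
        case 2
        then show ?thesis using \<open>0 < C\<close>
          by (simp add: boundary_jump_eq ennreal_mult_top)
      next
        case 3
        have "(1 + f y * b) powr \<delta> \<le> (C * (1 + f y * m)) powr \<delta>"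
          using elim 3 \<delta>_pos by (intro powr_mono2) auto
        also have "\<dots> = C powr \<delta> * (1 + f y * m) powr \<delta>"
          using elim \<open>0 < C\<close> by (simp add: powr_mult)
        finally have "jump \<delta> m (f y) \<le> C powr \<delta> * jump \<delta> b (f y)"
          using 3 elim \<open>0 < C\<close> unfolding jump_def by (simp add: field_simps mult_left_mono)
        moreover have "0 \<le> jump \<delta> m (f y)" using 3 by (simp add: jump_def)
        ultimately show ?thesis using 3
          by (simp add: boundary_jump_eq max_absorb2 ennreal_leI flip: ennreal_mult')
      qed
    qed
  qed
  also have "\<dots> = ennreal (C powr \<delta>) * boundary_pos b"
    unfolding boundary_pos_def by (intro nn_integral_cmult) measurable
  also have "\<dots> < \<infinity>" using pos by (simp add: ennreal_mult_less_top)
  finally show "(\<integral>\<^sup>+y. ennreal (norm (max 0 (jump \<delta> m (f y)))) \<partial>M) < \<infinity>" .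
qed measurable

text \<open>The locale assumptions do not mention \<open>c\<close>, so the locale predicate does not
  take it as an argument and the interpretation may choose \<open>- c\<close>.\<close>

lemma reflected: "jump_equation M (\<lambda>y. - f y) k \<delta>"
  by unfold_locales (use k_pos \<delta>_pos in auto)

end

text \<open>The reflection \<open>(f, c, m) \<mapsto> (-f, -c, -m)\<close> exchanges the two endpoints.\<close>

context jump_equation
begin

interpretation R: jump_equation M "\<lambda>y. - f y" "- c" k \<delta>
  by (rule reflected)

lemma admissible_reflect: "R.admissible m \<longleftrightarrow> admissible (- m)"
  using jump_uminus[of \<delta> "- m"] unfolding R.admissible_def admissible_def by simp

lemma F_reflect: "R.F m = - F (- m)"
  using jump_uminus[of \<delta> "- m"] unfolding R.F_def F_def by simp

lemma boundary_pos_reflect: "R.boundary_pos m = boundary_neg (- m)"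
  using boundary_jump_uminus[of \<delta> "- m"] unfolding R.boundary_pos_def boundary_neg_def by simp

lemma boundary_neg_reflect: "R.boundary_neg m = boundary_pos (- m)"
  using boundary_jump_uminus[of \<delta> "- m"] unfolding R.boundary_neg_def boundary_pos_def by simp

text \<open>The assumption excludes \<open>\<infinity> - \<infinity>\<close>, which evaluates to
  \<open>\<infinity>\<close> in ereal on both sides of the reflection and so would not change
  sign.\<close>

lemma boundary_value_reflect:
  assumes "boundary_pos (- m) < \<infinity> \<or> boundary_neg (- m) < \<infinity>"
  shows "R.boundary_value m = - boundary_value (- m)"
  using assms unfolding R.boundary_value_def boundary_value_def boundary_pos_reflect boundary_neg_reflect
  by (cases "boundary_pos (- m)"; cases "boundary_neg (- m)") auto

lemmas reflect = admissible_reflect F_reflect boundary_pos_reflect boundary_neg_reflect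

section \<open>The right endpoint by reflection, and jump sizes of both signs\<close>

lemma right_endpoint:
  assumes "a < b" and adm: "\<And>m. a \<le> m \<Longrightarrow> m < b \<Longrightarrow> admissible m"
    and nonneg: "AE y in M. 0 \<le> 1 + f y * b"
    and ex: "boundary_pos b < \<infinity> \<or> boundary_neg b < \<infinity>" and V: "boundary_value b \<le> 0"
  shows "\<exists>m. admissible m \<and> F m \<le> 0 \<and> (boundary_value b = 0 \<longrightarrow> m = b \<and> F m = 0) \<and>
           (boundary_value b \<noteq> 0 \<longrightarrow> m < b)"
proof -
  have "boundary_value b = - R.boundary_value (- b)"
    using boundary_value_reflect[of "- b"] ex by simp
  then obtain m where "R.admissible m" "0 \<le> R.F m" "boundary_value b = 0 \<longrightarrow> m = - b \<and> R.F m = 0"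
    "boundary_value b \<noteq> 0 \<longrightarrow> - b < m"
    using R.left_endpoint[of "- b" "- a"] assms by (auto simp: reflect)
  then show ?thesis by (intro exI[of _ "- m"]) (auto simp: reflect)
qed

lemma boundary_pos_finite:
  assumes "boundary_pos b < \<infinity> \<or> boundary_neg b < \<infinity>" "boundary_value b \<le> 0"
  shows "boundary_pos b < \<infinity>"
  using R.boundary_neg_finite[of "- b"] boundary_value_reflect[of "- b"] assms
  by (auto simp: reflect)

lemma zero_left_of:
  assumes int: "integrable M f" and f: "AE y in M. f y \<le> 0" and "0 \<le> b"
    and nonneg: "AE y in M. 0 \<le> 1 + f y * b"
    and ex: "boundary_pos b < \<infinity> \<or> boundary_neg b < \<infinity>" and V: "boundary_value b \<le> 0"
  shows "\<exists>m. admissible m \<and> F m = 0 \<and> (boundary_value b = 0 \<longrightarrow> m = b) \<and>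
           (boundary_value b \<noteq> 0 \<longrightarrow> m < b)"
proof -
  have "boundary_value b = - R.boundary_value (- b)"
    using boundary_value_reflect[of "- b"] ex by simp
  then obtain m where "R.admissible m" "R.F m = 0" "boundary_value b = 0 \<longrightarrow> m = - b"
    "boundary_value b \<noteq> 0 \<longrightarrow> - b < m"
    using R.zero_right_of[of "- b"] assms by (auto simp: reflect)
  then show ?thesis by (intro exI[of _ "- m"]) (auto simp: reflect)
qed

text \<open>The base at \<open>m\<close> is a convex combination of the nonnegative bases at
  \<open>a\<close> and \<open>b\<close>, so each of these is at most a constant times the base at
  \<open>m\<close>. The positive part of the jump term is then controlled from \<open>b\<close> and
  the negative part from \<open>a\<close>.\<close>

lemma admissible_inside:
  assumes "a < m" "m < b"
    and AE: "AE y in M. 0 \<le> 1 + f y * a" "AE y in M. 0 \<le> 1 + f y * b"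
    and fin: "boundary_neg a < \<infinity>" "boundary_pos b < \<infinity>"
  shows "admissible m"
proof -
  have inside: "AE y in M. 0 < 1 + f y * m
      \<and> 0 \<le> 1 + f y * b \<and> 1 + f y * b \<le> (b - a) / (m - a) * (1 + f y * m)
      \<and> 0 \<le> 1 + f y * a \<and> 1 + f y * a \<le> (b - a) / (b - m) * (1 + f y * m)"
    using AE
  proof eventually_elim
    case (elim y)
    have eq: "(b - a) * (1 + f y * m) = (b - m) * (1 + f y * a) + (m - a) * (1 + f y * b)"
      by (simp add: algebra_simps)
    have nn: "0 \<le> (b - m) * (1 + f y * a)" "0 \<le> (m - a) * (1 + f y * b)"
      using elim assms by auto
    \<comment> \<open>The two endpoint bases cannot both vanish: the jump size would then be 0 and
      the bases 1.\<close>
    have "(b - m) * (1 + f y * a) \<noteq> 0 \<or> (m - a) * (1 + f y * b) \<noteq> 0"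
    proof (rule ccontr)
      assume "\<not> ?thesis"
      then have *: "1 + f y * a = 0" "1 + f y * b = 0" using assms by auto
      then have "f y * b - f y * a = 0" by linarith
      then have "f y * (b - a) = 0" by (simp only: right_diff_distrib)
      with * assms show False by auto
    qed
    then have "0 < (b - a) * (1 + f y * m)" using nn eq by linarith
    then have "0 < 1 + f y * m" using assms by (simp add: zero_less_mult_iff)
    then show ?case using elim nn eq assms
      by (simp add: pos_le_divide_eq mult.commute)
  qed
  have "integrable M (\<lambda>y. max 0 (jump \<delta> m (f y)))"
  proof (rule integrable_pos_part_jump[OF fin(2)])
    show "AE y in M. 0 < 1 + f y * m \<and> (0 < f y \<longrightarrow> 0 \<le> 1 + f y * b \<and>
        1 + f y * b \<le> (b - a) / (m - a) * (1 + f y * m))"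
      using inside by eventually_elim blast
  qed (use assms in auto)
  \<comment> \<open>The negative part of the jump term is the positive part of the reflected one,
    and \<open>a\<close> becomes the right endpoint \<open>- a\<close>.\<close>
  moreover have "integrable M (\<lambda>y. max 0 (jump \<delta> (- m) (- f y)))"
  proof (rule R.integrable_pos_part_jump)
    show "R.boundary_pos (- a) < \<infinity>" using fin(1) by (simp add: reflect)
    show "AE y in M. 0 < 1 + - f y * - m \<and> (0 < - f y \<longrightarrow> 0 \<le> 1 + - f y * - a \<and>
        1 + - f y * - a \<le> (b - a) / (b - m) * (1 + - f y * - m))"
      unfolding minus_mult_minus using inside by eventually_elim blast
  qed (use assms in auto)
  ultimately have "integrable M (\<lambda>y. max 0 (jump \<delta> m (f y)) - max 0 (jump \<delta> (- m) (- f y)))"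
    by (rule Bochner_Integration.integrable_diff)
  moreover have "(\<lambda>y. max 0 (jump \<delta> m (f y)) - max 0 (jump \<delta> (- m) (- f y))) = (\<lambda>y. jump \<delta> m (f y))"
    by (auto simp: jump_uminus max_def)
  ultimately show ?thesis unfolding admissible_def using inside by (auto elim: eventually_mono)
qed

lemma zero_inside:
  assumes "a < b"
    and nonneg: "AE y in M. 0 \<le> 1 + f y * a" "AE y in M. 0 \<le> 1 + f y * b"
    and ex: "boundary_pos a < \<infinity> \<or> boundary_neg a < \<infinity>" "boundary_pos b < \<infinity> \<or> boundary_neg b < \<infinity>"
    and V: "0 \<le> boundary_value a" "boundary_value b \<le> 0"
  shows "\<exists>m. admissible m \<and> F m = 0 \<and>
           (boundary_value a = 0 \<longrightarrow> m = a) \<and> (boundary_value a \<noteq> 0 \<longrightarrow> a < m) \<and>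
           (boundary_value b = 0 \<longrightarrow> m = b) \<and> (boundary_value b \<noteq> 0 \<longrightarrow> m < b)"
proof -
  have adm: "admissible m" if "a < m" "m < b" for m
    using admissible_inside[OF that nonneg] boundary_neg_finite boundary_pos_finite ex V by blast
  \<comment> \<open>This interior point gives each endpoint lemma its own half of the interval; the
    name shadows the constant term of the equation.\<close>
  obtain c where c: "a < c" "c < b" using dense \<open>a < b\<close> by blast
  obtain m1 where m1: "admissible m1" "0 \<le> F m1"
    "boundary_value a = 0 \<longrightarrow> m1 = a \<and> F m1 = 0" "boundary_value a \<noteq> 0 \<longrightarrow> a < m1"
    using left_endpoint[OF c(1) adm nonneg(1) ex(1) V(1)] c by auto
  obtain m2 where m2: "admissible m2" "F m2 \<le> 0"
    "boundary_value b = 0 \<longrightarrow> m2 = b \<and> F m2 = 0" "boundary_value b \<noteq> 0 \<longrightarrow> m2 < b"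
    using right_endpoint[OF c(2) adm nonneg(2) ex(2) V(2)] c by auto
  obtain m where "m1 \<le> m" "m \<le> m2" "admissible m" "F m = 0"
    using zero_between[OF m1(1) m2(1) m1(2) m2(2)] by blast
  then show ?thesis
    using m1 m2 zero_unique[of m m1] zero_unique[of m m2] by (intro exI[of _ m]) auto
qed

end

text \<open>If a boundary value is exactly 0, the endpoint itself is the solution, so the open
  intervals are claimed only for nonzero values. With jumps of one sign just one endpoint condition
  is available, and integrability away from it comes from that of \<gamma>.\<close>

theorem proposition5p9:
  fixes \<mu> r \<sigma> \<delta>1 :: real and \<nu> :: "real measure" and E :: "real set"
    and \<gamma> :: "real \<Rightarrow> real" and \<phi>1 \<phi>2 V1 V2 :: ereal
  assumes "r > 0" and "\<sigma> > 0" and "0 < \<delta>1" and "\<delta>1 < 1"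
    and "sets \<nu> = sets borel" and "sigma_finite_measure \<nu>"
    and "E \<in> sets borel" and "E \<noteq> {}" and "emeasure \<nu> (UNIV - E) = 0"
    and "continuous_on E \<gamma>" and "\<gamma> ` E \<subseteq> {-1..}"
    and "\<phi>1 = (INF y\<in>E. ereal (\<gamma> y))" and "\<phi>2 = (SUP y\<in>E. ereal (\<gamma> y))"
    and "\<phi>1 \<noteq> 0" and "\<phi>2 \<noteq> 0"
    and "V1 = ereal (\<mu> - r) + ereal (\<delta>1 * \<sigma>\<^sup>2) / \<phi>1 + ext_integral \<nu> E (boundary_integrand \<delta>1 \<gamma> \<phi>1)"
    and "V2 = ereal (\<mu> - r) + ereal (\<delta>1 * \<sigma>\<^sup>2) / \<phi>2 + ext_integral \<nu> E (boundary_integrand \<delta>1 \<gamma> \<phi>2)"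
    and "\<phi>2 > 0 \<Longrightarrow> ext_integral_exists \<nu> E (boundary_integrand \<delta>1 \<gamma> \<phi>2) \<and> V2 \<ge> 0"
    and "\<phi>1 < 0 \<Longrightarrow> ext_integral_exists \<nu> E (boundary_integrand \<delta>1 \<gamma> \<phi>1) \<and> V1 \<le> 0"
    and "\<phi>2 < 0 \<or> 0 < \<phi>1 \<Longrightarrow> set_integrable \<nu> E \<gamma>"
  shows "(\<exists>!m. solves_equation \<mu> r \<sigma> \<delta>1 \<nu> E \<gamma> m) \<and>
    (\<forall>m. solves_equation \<mu> r \<sigma> \<delta>1 \<nu> E \<gamma> m \<longrightarrow>
      (-1 \<le> \<phi>1 \<and> \<phi>2 < 0 \<longrightarrow>
         (V1 \<noteq> 0 \<longrightarrow> ereal m \<in> {-\<infinity><..<-1/\<phi>1}) \<and>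
         (V1 = 0 \<longrightarrow> ereal m = -1/\<phi>1)) \<and>
      (0 < \<phi>1 \<and> \<phi>2 < \<infinity> \<longrightarrow>
         (V2 \<noteq> 0 \<longrightarrow> ereal m \<in> {-1/\<phi>2<..<\<infinity>}) \<and>
         (V2 = 0 \<longrightarrow> ereal m = -1/\<phi>2)) \<and>
      (-1 \<le> \<phi>1 \<and> \<phi>1 < 0 \<and> 0 < \<phi>2 \<and> \<phi>2 < \<infinity> \<longrightarrow>
         (V1 \<noteq> 0 \<and> V2 \<noteq> 0 \<longrightarrow> ereal m \<in> {-1/\<phi>2<..<-1/\<phi>1}) \<and>
         (V2 = 0 \<longrightarrow> ereal m = -1/\<phi>2) \<and>
         (V1 = 0 \<longrightarrow> ereal m = -1/\<phi>1)))"
proof -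
  define k where "k = \<delta>1 * \<sigma>\<^sup>2"
  have E: "E \<in> sets \<nu>" "space \<nu> = UNIV"
    using assms(5,7) sets_eq_imp_space_eq[OF assms(5)] by auto
  \<comment> \<open>On the measure restricted to \<open>E\<close>, continuity of \<gamma> on
    \<open>E\<close> gives its measurability.\<close>
  interpret J: jump_equation "restrict_space \<nu> E" \<gamma> "\<mu> - r" k \<delta>1
  proof
    have sets_eq: "sets (restrict_space \<nu> E) = sets (restrict_space borel E)"
      using assms(5) by (rule sets_restrict_space_cong)
    show "\<gamma> \<in> borel_measurable (restrict_space \<nu> E)"
      unfolding measurable_cong_sets[OF sets_eq refl]
      using borel_measurable_continuous_on_restrict[OF assms(10)] by simp
  qed (use assms in \<open>auto simp: k_def\<close>)
  have AE_I: "AE y in restrict_space \<nu> E. P y" if "\<And>y. y \<in> E \<Longrightarrow> P y" for P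
    using that E by (auto simp: space_restrict_space)
  have solves: "solves_equation \<mu> r \<sigma> \<delta>1 \<nu> E \<gamma> m \<longleftrightarrow> J.admissible m \<and> J.F m = 0" for m
    unfolding solves_equation_def J.admissible_def J.F_def set_integrable_def
      set_lebesgue_integral_def jump_def k_def[symmetric] using E
    by (simp add: AE_restrict_space_iff integrable_restrict_space integral_restrict_space)
  have unique: "m = m'" if "solves_equation \<mu> r \<sigma> \<delta>1 \<nu> E \<gamma> m" "solves_equation \<mu> r \<sigma> \<delta>1 \<nu> E \<gamma> m'" for m m'
    using that J.zero_unique unfolding solves by blast
  \<comment> \<open>The condition on \<open>a\<close> says that it is -1/\<phi>, in a form that
    includes \<phi> = \<infinity> with \<open>a = 0\<close>.\<close>
  have boundary:
    "ext_integral_exists \<nu> E (boundary_integrand \<delta>1 \<gamma> \<phi>) \<longleftrightarrow>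
       J.boundary_pos a < \<infinity> \<or> J.boundary_neg a < \<infinity>"
    "ereal (\<mu> - r) + ereal (\<delta>1 * \<sigma>\<^sup>2) / \<phi> + ext_integral \<nu> E (boundary_integrand \<delta>1 \<gamma> \<phi>) =
       J.boundary_value a"
    if a: "\<And>t. ereal t / \<phi> = ereal (- (t * a))" for \<phi> a
  proof -
    have h: "boundary_integrand \<delta>1 \<gamma> \<phi> = (\<lambda>y. boundary_jump \<delta>1 a (\<gamma> y))"
      by (auto simp: fun_eq_iff boundary_integrand_def boundary_jump_def a one_ereal_def)
    have P: "(\<integral>\<^sup>+y\<in>E. e2ennreal (boundary_integrand \<delta>1 \<gamma> \<phi> y) \<partial>\<nu>) = J.boundary_pos a"
      and N: "(\<integral>\<^sup>+y\<in>E. e2ennreal (- boundary_integrand \<delta>1 \<gamma> \<phi> y) \<partial>\<nu>) = J.boundary_neg a"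
      unfolding h J.boundary_pos_def J.boundary_neg_def using E
      by (simp_all add: nn_integral_restrict_space)
    show "ext_integral_exists \<nu> E (boundary_integrand \<delta>1 \<gamma> \<phi>) \<longleftrightarrow>
       J.boundary_pos a < \<infinity> \<or> J.boundary_neg a < \<infinity>"
      unfolding ext_integral_exists_def P N ..
    show "ereal (\<mu> - r) + ereal (\<delta>1 * \<sigma>\<^sup>2) / \<phi> + ext_integral \<nu> E (boundary_integrand \<delta>1 \<gamma> \<phi>) =
       J.boundary_value a"
      unfolding ext_integral_def P N J.boundary_value_def a k_def[symmetric] by simp
  qed
  have bounds: "\<phi>1 \<le> ereal (\<gamma> y)" "ereal (\<gamma> y) \<le> \<phi>2" if "y \<in> E" for y
    unfolding assms(12,13) using that by (auto intro: INF_lower SUP_upper)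
  obtain y0 where "y0 \<in> E" using assms(8) by blast
  have "-1 \<le> \<phi>1"
    unfolding assms(12) using assms(11) by (intro INF_greatest) (auto simp: one_ereal_def)
  then obtain p1 where p1: "\<phi>1 = ereal p1" "p1 \<noteq> 0"
    using bounds(1)[OF \<open>y0 \<in> E\<close>] assms(14) by (cases \<phi>1) (auto simp: one_ereal_def)
  define b where "b = - 1 / p1"
  have b: "ereal t / \<phi>1 = ereal (- (t * b))" for t
    using p1 by (simp add: b_def)
  have b': "- 1 / \<phi>1 = ereal b" using p1 by (simp add: b_def one_ereal_def)
  have p1_le: "p1 \<le> \<gamma> y" if "y \<in> E" for y using bounds(1)[OF that] p1 by simp
  define a where "a = (if \<phi>2 = \<infinity> then 0 else - 1 / real_of_ereal \<phi>2)"
  have \<phi>2: "\<phi>2 = \<infinity> \<or> (\<exists>p2. \<phi>2 = ereal p2 \<and> p2 \<noteq> 0)"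
    using bounds(2)[OF \<open>y0 \<in> E\<close>] assms(15) by (cases \<phi>2) auto
  have a: "ereal t / \<phi>2 = ereal (- (t * a))" for t
    using \<phi>2 by (auto simp: a_def)
  have a': "- 1 / \<phi>2 = ereal a" using \<phi>2 by (auto simp: a_def one_ereal_def)
  have V: "V1 = J.boundary_value b" "V2 = J.boundary_value a"
    unfolding assms(16,17) using boundary(2)[OF b] boundary(2)[OF a] by auto
  have exists_b: "J.boundary_pos b < \<infinity> \<or> J.boundary_neg b < \<infinity>" and V_b: "J.boundary_value b \<le> 0"
    if "\<phi>1 < 0"
    using assms(19)[OF that] boundary(1)[OF b] V by auto
  have exists_a: "J.boundary_pos a < \<infinity> \<or> J.boundary_neg a < \<infinity>" and V_a: "0 \<le> J.boundary_value a"
    if "0 < \<phi>2"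
    using assms(18)[OF that] boundary(1)[OF a] V by auto
  have b_nonzero: "b \<noteq> 0" using p1 by (simp add: b_def)
  have b_nonneg: "0 \<le> b" if "\<phi>1 < 0" using that p1 by (simp add: b_def field_simps)
  have nonneg_b: "AE y in restrict_space \<nu> E. 0 \<le> 1 + \<gamma> y * b" if "\<phi>1 < 0"
    using that p1 p1_le by (intro AE_I) (auto simp: b_def field_simps)
  have nonneg_a: "AE y in restrict_space \<nu> E. 0 \<le> 1 + \<gamma> y * a" and a_nonpos: "a \<le> 0" if "0 < \<phi>2"
    using \<phi>2 that bounds(2) by (auto intro!: AE_I simp: a_def field_simps)
  have int: "integrable (restrict_space \<nu> E) \<gamma>" if "\<phi>2 < 0 \<or> 0 < \<phi>1"
    using assms(20)[OF that] E by (simp add: set_integrable_def integrable_restrict_space)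
  have "\<phi>1 \<le> \<phi>2" using bounds[OF \<open>y0 \<in> E\<close>] by (rule order_trans)
  then consider "\<phi>2 < 0" "\<phi>1 < 0" | "0 < \<phi>1" "0 < \<phi>2" | "\<phi>1 < 0" "0 < \<phi>2"
    using assms(14,15) by (metis linorder_neqE order.strict_trans2)
  \<comment> \<open>One conclusion serves all three sign cases: each endpoint clause is guarded by
    the sign that makes the endpoint relevant.\<close>
  then have "\<exists>m. J.admissible m \<and> J.F m = 0 \<and>
      (\<phi>1 < 0 \<longrightarrow> (V1 = 0 \<longrightarrow> m = b) \<and> (V1 \<noteq> 0 \<longrightarrow> m < b)) \<and>
      (0 < \<phi>2 \<longrightarrow> (V2 = 0 \<longrightarrow> m = a) \<and> (V2 \<noteq> 0 \<longrightarrow> a < m))"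
  proof cases
    case 1
    have "AE y in restrict_space \<nu> E. \<gamma> y \<le> 0"
    proof (rule AE_I)
      fix y assume "y \<in> E"
      have "ereal (\<gamma> y) < 0" using bounds(2)[OF \<open>y \<in> E\<close>] 1(1) by (rule le_less_trans)
      then show "\<gamma> y \<le> 0" by simp
    qed
    from J.zero_left_of[OF int this b_nonneg nonneg_b exists_b V_b] 1 show ?thesis
      by (auto simp: V)
  next
    case 2
    have "AE y in restrict_space \<nu> E. 0 \<le> \<gamma> y"
    proof (rule AE_I)
      fix y assume "y \<in> E"
      have "0 < ereal (\<gamma> y)" using 2(1) bounds(1)[OF \<open>y \<in> E\<close>] by (rule less_le_trans)
      then show "0 \<le> \<gamma> y" by simp
    qed
    from J.zero_right_of[OF int this a_nonpos nonneg_a exists_a V_a] 2 show ?thesis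
      by (auto simp: V)
  next
    case 3
    \<comment> \<open>The left endpoint may be 0, namely for \<phi>2 = \<infinity>; strictness comes
      from \<open>b\<close>, which is nonzero because \<phi>1 is finite.\<close>
    then have "a < b" using a_nonpos b_nonneg b_nonzero by fastforce
    from J.zero_inside[OF this nonneg_a nonneg_b exists_a exists_b V_a V_b] 3 show ?thesis
      by (auto simp: V)
  qed
  then obtain m where m: "solves_equation \<mu> r \<sigma> \<delta>1 \<nu> E \<gamma> m"
    "\<phi>1 < 0 \<Longrightarrow> V1 = 0 \<Longrightarrow> m = b" "\<phi>1 < 0 \<Longrightarrow> V1 \<noteq> 0 \<Longrightarrow> m < b"
    "0 < \<phi>2 \<Longrightarrow> V2 = 0 \<Longrightarrow> m = a" "0 < \<phi>2 \<Longrightarrow> V2 \<noteq> 0 \<Longrightarrow> a < m"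
    unfolding solves by blast
  have "\<phi>2 < 0 \<Longrightarrow> \<phi>1 < 0" "0 < \<phi>1 \<Longrightarrow> 0 < \<phi>2"
    using \<open>\<phi>1 \<le> \<phi>2\<close> by auto
  with m have "\<exists>!m. solves_equation \<mu> r \<sigma> \<delta>1 \<nu> E \<gamma> m" 
    using unique by blast
  moreover have "m' = m" if "solves_equation \<mu> r \<sigma> \<delta>1 \<nu> E \<gamma> m'" for m'
    using unique that m(1) by blast
  ultimately show ?thesis
    using m(2-) \<open>\<phi>2 < 0 \<Longrightarrow> \<phi>1 < 0\<close> \<open>0 < \<phi>1 \<Longrightarrow> 0 < \<phi>2\<close> unfolding a' b'
    by (intro conjI allI impI) auto
qed

end
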